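(* Let $(\Phi,h)$ be a list-weighted gain graph with vertices $v_1,\dots,v_n$ and let $M_1,\dots,M_n\subseteq\mathfrak{C}$ be such that $M_i\cap h_i$ is finite for each $i$. Then the list chromatic function $\chi_{(\Phi,h)}(M_1,\dots,M_n)$ is obtained from $(-1)^nQ_{(\Phi,h),M}(\mathbf{u},-1,0)$ by setting $u_{h',M'}=-|M'\cap h'|$ for each $(h',M')\in\mathfrak{M}_0$.
   Context: $\Phi$ is a gain graph on a finite graph with vertex set $V$ and edge set $E$ (links, loops, half edges, loose edges allowed), lattice-ordered gain group $\mathfrak{G}$, gains on links and loops with $\varphi(e^{-1})=\varphi(e)^{-1}$; a loose edge is treated as a loop of gain $1$. An edge set is balanced if it has no half edges and all its circles have gain $1$. For $S\subseteq E$: $c(S)$ is the number of connected components of $(V,S)$, $b(S)$ the number of balanced ones, $\pi_b(S)$ their vertex sets; for a balanced component with vertex set $W$ and $v\in W$, $\eta_S(v)=\bigvee_{w\in W}\varphi(S_{vw})$, $S_{vw}$ any path in $S$ from $v$ to $w$. The color set $\mathfrak{C}$ carries a fixed-point-free right action of $\mathfrak{G}$; the lists $h_i$ come from a class $\mathfrak{W}$ of subsets of $\mathfrak{C}$ closed under intersection and the $\mathfrak{G}$-action. $\mathfrak{M}_0=\{(h',M'):h'\in\mathfrak{W},\ M'\subseteq\mathfrak{C},\ M'\cap h'\text{ finite}\}$. For $W\in\pi_b(S)$, $h/S(W)=\bigcap_{v_i\in W}h_i\eta_S(v_i)$, $M/S(W)=\bigcap_{v_i\in W}M_i\eta_S(v_i)$.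 The doubly weighted total dichromatic polynomial, with indeterminates $u_{h',M'}$ for $(h',M')\in\mathfrak{M}_0$ and $v,z$, is $Q_{(\Phi,h),M}(\mathbf{u},v,z)=\sum_{S\subseteq E}v^{|S|-n+b(S)}z^{c(S)-b(S)}\prod_{W\in\pi_b(S)}u_{h/S(W),M/S(W)}$, with $0^0=1$. $\chi_{(\Phi,h)}(M_1,\dots,M_n)$ is the number of $x:V\to\mathfrak{C}$ with $x_i\in h_i\cap M_i$ and $x_j\ne x_i\varphi(e_{ij})$ for each link or loop $e_{ij}$ (loose edges always improper). *)

theory Defs
  imports "HOL-Library.Poly_Mapping" "HOL-Library.FuncSet"
begin

section \<open>Lattice-ordered groups\<close>

text \<open>Multiplicative and not necessarily commutative; the library only has the abelian additive
  \<open>lattice_ab_group_add\<close>.\<close>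

class lattice_group_mult = monoid_mult + inverse + lattice +
  assumes group_left_inverse: "inverse a * a = 1"
    and group_divide_inverse: "a / b = a * inverse b"
    and group_mult_left_mono: "a \<le> b \<Longrightarrow> c * a \<le> c * b"
    and group_mult_right_mono: "a \<le> b \<Longrightarrow> a * c \<le> b * c"


section \<open>Gain graphs\<close>

datatype (incident: 'v) incidence =
    is_Link: Link 'v 'v
  | is_Loop: Loop 'v
  | is_Half: Half 'v
  | is_Loose: Loose

text \<open>An oriented edge is a pair \<open>(e, d)\<close>: for \<open>ends \<Phi> e = Link v w\<close>, the orientation
  \<open>d = True\<close> runs from \<open>v\<close> to \<open>w\<close> and \<open>d = False\<close> from \<open>w\<close> to \<open>v\<close>.  A loop also has two
  orientations, with mutually inverse gains.  The values of \<open>gain\<close> on half and loose edges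
  are never used.\<close>

record ('v, 'e, 'g) gain_graph =
  verts :: "'v set"
  edges :: "'e set"
  ends :: "'e \<Rightarrow> 'v incidence"
  gain :: "'e \<times> bool \<Rightarrow> 'g"

definition link_or_loop :: "('v, 'e, 'g) gain_graph \<Rightarrow> 'e \<Rightarrow> bool" where
  "link_or_loop \<Phi> e \<longleftrightarrow> is_Link (ends \<Phi> e) \<or> is_Loop (ends \<Phi> e)"

locale finite_gain_graph =
  fixes \<Phi> :: "('v, 'e, 'g::lattice_group_mult) gain_graph"
  assumes finite_verts: "finite (verts \<Phi>)"
    and finite_edges: "finite (edges \<Phi>)"
    and incident_verts: "e \<in> edges \<Phi> \<Longrightarrow> incident (ends \<Phi> e) \<subseteq> verts \<Phi>"
    and link_distinct: "e \<in> edges \<Phi> \<Longrightarrow> ends \<Phi> e = Link v w \<Longrightarrow> v \<noteq> w"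
    and gain_reverse: "e \<in> edges \<Phi> \<Longrightarrow> link_or_loop \<Phi> e \<Longrightarrow>
      gain \<Phi> (e, \<not> d) = inverse (gain \<Phi> (e, d))"

definition tail :: "('v, 'e, 'g) gain_graph \<Rightarrow> 'e \<times> bool \<Rightarrow> 'v" where
  "tail \<Phi> a = (case ends \<Phi> (fst a) of
      Link v w \<Rightarrow> if snd a then v else w | Loop v \<Rightarrow> v | Half v \<Rightarrow> v | Loose \<Rightarrow> undefined)"

definition head :: "('v, 'e, 'g) gain_graph \<Rightarrow> 'e \<times> bool \<Rightarrow> 'v" where
  "head \<Phi> a = (case ends \<Phi> (fst a) of
      Link v w \<Rightarrow> if snd a then w else v | Loop v \<Rightarrow> v | Half v \<Rightarrow> v | Loose \<Rightarrow> undefined)"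

fun walk :: "('v, 'e, 'g) gain_graph \<Rightarrow> 'e set \<Rightarrow> 'v \<Rightarrow> ('e \<times> bool) list \<Rightarrow> 'v \<Rightarrow> bool" where
  "walk \<Phi> S v [] w \<longleftrightarrow> v \<in> verts \<Phi> \<and> v = w"
| "walk \<Phi> S v (a # p) w \<longleftrightarrow>
    fst a \<in> S \<and> link_or_loop \<Phi> (fst a) \<and> tail \<Phi> a = v \<and> walk \<Phi> S (head \<Phi> a) p w"

definition path :: "('v, 'e, 'g) gain_graph \<Rightarrow> 'e set \<Rightarrow> 'v \<Rightarrow> ('e \<times> bool) list \<Rightarrow> 'v \<Rightarrow> bool" where
  "path \<Phi> S v p w \<longleftrightarrow> walk \<Phi> S v p w \<and> distinct (v # map (head \<Phi>) p)"

definition walk_gain :: "('v, 'e, 'g::monoid_mult) gain_graph \<Rightarrow> ('e \<times> bool) list \<Rightarrow> 'g" where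
  "walk_gain \<Phi> p = prod_list (map (gain \<Phi>) p)"

text \<open>A circle, traversed from some vertex in some direction; loops and pairs of parallel links
  count.  Distinctness of the edges only matters for length 2, where it excludes going back
  along the same link.\<close>

definition circle :: "('v, 'e, 'g) gain_graph \<Rightarrow> 'e set \<Rightarrow> ('e \<times> bool) list \<Rightarrow> bool" where
  "circle \<Phi> S p \<longleftrightarrow> p \<noteq> [] \<and> (\<exists>v. walk \<Phi> S v p v) \<and>
     distinct (map (tail \<Phi>) p) \<and> distinct (map fst p)"

text \<open>Loose edges, being treated as loops of gain 1, do not affect balance.\<close>

definition balanced :: "('v, 'e, 'g::monoid_mult) gain_graph \<Rightarrow> 'e set \<Rightarrow> bool" where
  "balanced \<Phi> S \<longleftrightarrow> (\<forall>e\<in>S. \<not> is_Half (ends \<Phi> e)) \<and> (\<forall>p. circle \<Phi> S p \<longrightarrow> walk_gain \<Phi> p = 1)"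

definition connected_rel :: "('v, 'e, 'g) gain_graph \<Rightarrow> 'e set \<Rightarrow> ('v \<times> 'v) set" where
  "connected_rel \<Phi> S = {(v, w). v \<in> verts \<Phi> \<and> w \<in> verts \<Phi> \<and> (\<exists>p. walk \<Phi> S v p w)}"

definition comps :: "('v, 'e, 'g) gain_graph \<Rightarrow> 'e set \<Rightarrow> 'v set set" where
  "comps \<Phi> S = verts \<Phi> // connected_rel \<Phi> S"

definition comp_edges :: "('v, 'e, 'g) gain_graph \<Rightarrow> 'e set \<Rightarrow> 'v set \<Rightarrow> 'e set" where
  "comp_edges \<Phi> S W = {e \<in> S. incident (ends \<Phi> e) \<noteq> {} \<and> incident (ends \<Phi> e) \<subseteq> W}"

definition bal_comps :: "('v, 'e, 'g::monoid_mult) gain_graph \<Rightarrow> 'e set \<Rightarrow> 'v set set" where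
  "bal_comps \<Phi> S = {W \<in> comps \<Phi> S. balanced \<Phi> (comp_edges \<Phi> S W)}"

definition num_comps :: "('v, 'e, 'g) gain_graph \<Rightarrow> 'e set \<Rightarrow> nat" where
  "num_comps \<Phi> S = card (comps \<Phi> S)"

definition num_bal_comps :: "('v, 'e, 'g::monoid_mult) gain_graph \<Rightarrow> 'e set \<Rightarrow> nat" where
  "num_bal_comps \<Phi> S = card (bal_comps \<Phi> S)"

text \<open>Within a balanced component the gain does not depend on the chosen path.\<close>

definition path_gain :: "('v, 'e, 'g::monoid_mult) gain_graph \<Rightarrow> 'e set \<Rightarrow> 'v \<Rightarrow> 'v \<Rightarrow> 'g" where
  "path_gain \<Phi> S v w = walk_gain \<Phi> (SOME p. path \<Phi> S v p w)"

definition eta :: "('v, 'e, 'g::lattice_group_mult) gain_graph \<Rightarrow> 'e set \<Rightarrow> 'v \<Rightarrow> 'g" where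
  "eta \<Phi> S v = Sup_fin (path_gain \<Phi> S v ` (connected_rel \<Phi> S `` {v}))"


section \<open>Colors and lists\<close>

locale color_action =
  fixes C :: "'c set" and act :: "'c \<Rightarrow> 'g::lattice_group_mult \<Rightarrow> 'c"
  assumes act_closed: "x \<in> C \<Longrightarrow> act x g \<in> C"
    and act_one: "x \<in> C \<Longrightarrow> act x 1 = x"
    and act_mult: "x \<in> C \<Longrightarrow> act x (g * h) = act (act x g) h"
    and act_fixed_point_free: "x \<in> C \<Longrightarrow> act x g = x \<Longrightarrow> g = 1"

definition set_act :: "('c \<Rightarrow> 'g \<Rightarrow> 'c) \<Rightarrow> 'c set \<Rightarrow> 'g \<Rightarrow> 'c set" where
  "set_act act A g = (\<lambda>x. act x g) ` A"

locale list_class = color_action C act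
  for C :: "'c set" and act :: "'c \<Rightarrow> 'g::lattice_group_mult \<Rightarrow> 'c" +
  fixes \<WW> :: "'c set set"
  assumes lists_subset: "A \<in> \<WW> \<Longrightarrow> A \<subseteq> C"
    and lists_Int: "A \<in> \<WW> \<Longrightarrow> B \<in> \<WW> \<Longrightarrow> A \<inter> B \<in> \<WW>"
    and lists_act: "A \<in> \<WW> \<Longrightarrow> set_act act A g \<in> \<WW>"

definition M0 :: "'c set \<Rightarrow> 'c set set \<Rightarrow> ('c set \<times> 'c set) set" where
  "M0 C \<WW> = {(h', M'). h' \<in> \<WW> \<and> M' \<subseteq> C \<and> finite (M' \<inter> h')}"

text \<open>\<open>contract \<Phi> act h S W\<close> is \<open>h/S(W)\<close>, and likewise for \<open>M\<close> in place of \<open>h\<close>.\<close>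

definition contract ::
  "('v, 'e, 'g::lattice_group_mult) gain_graph \<Rightarrow> ('c \<Rightarrow> 'g \<Rightarrow> 'c) \<Rightarrow> ('v \<Rightarrow> 'c set) \<Rightarrow>
    'e set \<Rightarrow> 'v set \<Rightarrow> 'c set" where
  "contract \<Phi> act h S W = (\<Inter>v\<in>W. set_act act (h v) (eta \<Phi> S v))"

text \<open>Half edges impose no restriction; a loose edge makes every coloring improper.\<close>

definition proper_edge ::
  "('v, 'e, 'g) gain_graph \<Rightarrow> ('c \<Rightarrow> 'g \<Rightarrow> 'c) \<Rightarrow> ('v \<Rightarrow> 'c) \<Rightarrow> 'e \<Rightarrow> bool" where
  "proper_edge \<Phi> act x e \<longleftrightarrow> \<not> is_Loose (ends \<Phi> e) \<and>
     (link_or_loop \<Phi> e \<longrightarrow>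
       (\<forall>d. x (head \<Phi> (e, d)) \<noteq> act (x (tail \<Phi> (e, d))) (gain \<Phi> (e, d))))"

definition list_chromatic ::
  "('v, 'e, 'g) gain_graph \<Rightarrow> ('c \<Rightarrow> 'g \<Rightarrow> 'c) \<Rightarrow> ('v \<Rightarrow> 'c set) \<Rightarrow> ('v \<Rightarrow> 'c set) \<Rightarrow> nat" where
  "list_chromatic \<Phi> act h M =
     card {x \<in> (\<Pi>\<^sub>E v\<in>verts \<Phi>. h v \<inter> M v). \<forall>e\<in>edges \<Phi>. proper_edge \<Phi> act x e}"


section \<open>The total dichromatic polynomial\<close>

text \<open>Integer polynomials in indeterminates of type \<open>'x\<close>, as finitely supported maps from
  monomials to coefficients.\<close>

type_synonym 'x int_mpoly = "('x \<Rightarrow>\<^sub>0 nat) \<Rightarrow>\<^sub>0 int"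

definition indet :: "'x \<Rightarrow> 'x int_mpoly" where
  "indet x = Poly_Mapping.single (Poly_Mapping.single x 1) 1"

definition eval_mpoly :: "('x \<Rightarrow> int) \<Rightarrow> 'x int_mpoly \<Rightarrow> int" where
  "eval_mpoly \<sigma> p = (\<Sum>m\<in>Poly_Mapping.keys p. Poly_Mapping.lookup p m *
     (\<Prod>x\<in>Poly_Mapping.keys m. \<sigma> x ^ Poly_Mapping.lookup m x))"

text \<open>\<open>Ind_u h' M'\<close> is only meant for \<open>(h', M') \<in> M0 C \<WW>\<close>.\<close>

datatype 'c dichromatic_indet = Ind_u "'c set" "'c set" | Ind_v | Ind_z

text \<open>The subtractions of exponents do not truncate: always \<open>n - b(S) \<le> |S|\<close>
  and \<open>b(S) \<le> c(S)\<close>.\<close>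

definition total_dichromatic ::
  "('v, 'e, 'g::lattice_group_mult) gain_graph \<Rightarrow> ('c \<Rightarrow> 'g \<Rightarrow> 'c) \<Rightarrow> ('v \<Rightarrow> 'c set) \<Rightarrow>
    ('v \<Rightarrow> 'c set) \<Rightarrow> 'c dichromatic_indet int_mpoly" where
  "total_dichromatic \<Phi> act h M =
     (\<Sum>S\<in>Pow (edges \<Phi>).
        indet Ind_v ^ (card S + num_bal_comps \<Phi> S - card (verts \<Phi>)) *
        indet Ind_z ^ (num_comps \<Phi> S - num_bal_comps \<Phi> S) *
        (\<Prod>W\<in>bal_comps \<Phi> S. indet (Ind_u (contract \<Phi> act h S W) (contract \<Phi> act M S W))))"

end

theory Submission
  imports Defs
begin

text \<open>Inclusion-exclusion over the set of improper edges gives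
  \<open>\<chi> = \<Sum>\<^bsub>S \<subseteq> E\<^esub> (-1)\<^bsup>|S|\<^esup> N(S)\<close>, where \<open>N(S)\<close> counts the colorings that are improper on every
  edge of \<open>S\<close>.  Such a coloring satisfies \<open>x\<^sub>w = x\<^sub>v \<phi>(p)\<close> along every walk \<open>p\<close> in \<open>S\<close> from \<open>v\<close> to
  \<open>w\<close>; since the action is fixed-point free, \<open>N(S) = 0\<close> unless \<open>S\<close> is balanced, and these are
  exactly the terms removed by \<open>z = 0\<close>.  If \<open>S\<close> is balanced, then the gain of a walk depends only
  on its ends, so \<open>x\<^sub>v \<eta>\<^sub>S(v)\<close> is constant on each component \<open>W\<close> and ranges over
  \<open>h/S(W) \<inter> M/S(W)\<close> independently for different \<open>W\<close>.  Hence \<open>N(S)\<close> is the product of the sizes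
  of these sets.\<close>

section \<open>Evaluation of polynomials\<close>

definition eval_monomial :: "('x \<Rightarrow> int) \<Rightarrow> ('x \<Rightarrow>\<^sub>0 nat) \<Rightarrow> int" where
  "eval_monomial \<sigma> m = (\<Prod>x\<in>Poly_Mapping.keys m. \<sigma> x ^ Poly_Mapping.lookup m x)"

text \<open>Indeterminates outside the support have exponent 0 and contribute the factor 1, so
  monomials with different supports can be evaluated over one common index set.\<close>

lemma eval_monomial_superset:
  assumes "finite A" "Poly_Mapping.keys m \<subseteq> A"
  shows "eval_monomial \<sigma> m = (\<Prod>x\<in>A. \<sigma> x ^ Poly_Mapping.lookup m x)"
  unfolding eval_monomial_def using assms
  by (intro prod.mono_neutral_left) (auto simp: in_keys_iff)

lemma eval_monomial_add: "eval_monomial \<sigma> (m + m') = eval_monomial \<sigma> m * eval_monomial \<sigma> m'"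
proof -
  let ?A = "Poly_Mapping.keys m \<union> Poly_Mapping.keys m'"
  have "eval_monomial \<sigma> (m + m') = (\<Prod>x\<in>?A. \<sigma> x ^ Poly_Mapping.lookup (m + m') x)"
    by (rule eval_monomial_superset) (auto simp: Poly_Mapping.keys_add)
  moreover have "eval_monomial \<sigma> m = (\<Prod>x\<in>?A. \<sigma> x ^ Poly_Mapping.lookup m x)"
    by (rule eval_monomial_superset) auto
  moreover have "eval_monomial \<sigma> m' = (\<Prod>x\<in>?A. \<sigma> x ^ Poly_Mapping.lookup m' x)"
    by (rule eval_monomial_superset) auto
  ultimately show ?thesis
    by (simp add: lookup_add power_add prod.distrib)
qed

lemma eval_mpoly_superset:
  assumes "finite A" "Poly_Mapping.keys p \<subseteq> A"
  shows "eval_mpoly \<sigma> p = (\<Sum>m\<in>A. Poly_Mapping.lookup p m * eval_monomial \<sigma> m)"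
  unfolding eval_mpoly_def eval_monomial_def[symmetric] using assms
  by (intro sum.mono_neutral_left) (auto simp: in_keys_iff)

lemma eval_mpoly_zero: "eval_mpoly \<sigma> 0 = 0"
  by (simp add: eval_mpoly_def)

lemma eval_mpoly_single: "eval_mpoly \<sigma> (Poly_Mapping.single m c) = c * eval_monomial \<sigma> m"
  by (subst eval_mpoly_superset[of "{m}"]) auto

lemma eval_mpoly_add: "eval_mpoly \<sigma> (p + q) = eval_mpoly \<sigma> p + eval_mpoly \<sigma> q"
proof -
  let ?A = "Poly_Mapping.keys p \<union> Poly_Mapping.keys q"
  have "eval_mpoly \<sigma> (p + q) = (\<Sum>m\<in>?A. Poly_Mapping.lookup (p + q) m * eval_monomial \<sigma> m)"
    by (rule eval_mpoly_superset) (auto simp: Poly_Mapping.keys_add)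
  moreover have "eval_mpoly \<sigma> p = (\<Sum>m\<in>?A. Poly_Mapping.lookup p m * eval_monomial \<sigma> m)"
    by (rule eval_mpoly_superset) auto
  moreover have "eval_mpoly \<sigma> q = (\<Sum>m\<in>?A. Poly_Mapping.lookup q m * eval_monomial \<sigma> m)"
    by (rule eval_mpoly_superset) auto
  ultimately show ?thesis
    by (simp add: lookup_add distrib_right sum.distrib)
qed

lemma eval_mpoly_diff: "eval_mpoly \<sigma> (p - q) = eval_mpoly \<sigma> p - eval_mpoly \<sigma> q"
  using eval_mpoly_add[of \<sigma> "p - q" q] by simp

lemma eval_mpoly_one: "eval_mpoly \<sigma> 1 = 1"
  using eval_mpoly_single[of \<sigma> 0 1] by (simp add: eval_monomial_def)

text \<open>Integer polynomials form the free abelian group on the monomials. Both sides are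
  additive in \<open>q\<close>, so it suffices to check a single monomial with coefficient 1, which
  is the generator form of \<open>frag_induction\<close>.\<close>

lemma eval_mpoly_single_mult:
  "eval_mpoly \<sigma> (Poly_Mapping.single m 1 * q) = eval_monomial \<sigma> m * eval_mpoly \<sigma> q"
proof (induction q rule: frag_induction[OF subset_UNIV, case_names zero one diff])
  case zero
  show ?case by (simp add: eval_mpoly_zero)
next
  case (one m')
  show ?case by (simp add: mult_single eval_mpoly_single eval_monomial_add)
next
  case (diff q r)
  then show ?case by (simp add: right_diff_distrib eval_mpoly_diff)
qed

lemma eval_mpoly_mult: "eval_mpoly \<sigma> (p * q) = eval_mpoly \<sigma> p * eval_mpoly \<sigma> q"
proof (induction p rule: frag_induction[OF subset_UNIV, case_names zero one diff])
  case zero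
  show ?case by (simp add: eval_mpoly_zero)
next
  case (one m)
  show ?case by (simp add: eval_mpoly_single_mult eval_mpoly_single)
next
  case (diff p r)
  then show ?case by (simp add: left_diff_distrib eval_mpoly_diff)
qed

lemma eval_mpoly_power: "eval_mpoly \<sigma> (p ^ k) = eval_mpoly \<sigma> p ^ k"
  by (induction k) (simp_all add: eval_mpoly_one eval_mpoly_mult)

lemma eval_mpoly_sum: "eval_mpoly \<sigma> (sum f A) = (\<Sum>a\<in>A. eval_mpoly \<sigma> (f a))"
  by (induction A rule: infinite_finite_induct) (simp_all add: eval_mpoly_zero eval_mpoly_add)

lemma eval_mpoly_prod: "eval_mpoly \<sigma> (prod f A) = (\<Prod>a\<in>A. eval_mpoly \<sigma> (f a))"
  by (induction A rule: infinite_finite_induct) (simp_all add: eval_mpoly_one eval_mpoly_mult)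

lemma eval_mpoly_indet: "eval_mpoly \<sigma> (indet x) = \<sigma> x"
  by (simp add: indet_def eval_mpoly_single eval_monomial_def)


section \<open>Lattice-ordered groups\<close>

lemma group_right_inverse:
  fixes a :: "'g::lattice_group_mult"
  shows "a * inverse a = 1"
proof -
  have "a * inverse a = inverse (inverse a) * inverse a * (a * inverse a)"
    by (simp add: group_left_inverse)
  also have "\<dots> = inverse (inverse a) * (inverse a * a) * inverse a"
    by (simp only: mult.assoc)
  finally show ?thesis by (simp add: group_left_inverse)
qed

lemma group_cancel_left:
  fixes a :: "'g::lattice_group_mult"
  shows "inverse a * (a * b) = b" "a * (inverse a * b) = b"
  by (simp_all add: mult.assoc[symmetric] group_left_inverse group_right_inverse)

text \<open>Left multiplication by \<open>c\<close> is monotone with a monotone inverse, hence an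
  order automorphism, and these preserve joins.\<close>

lemma group_mult_sup:
  fixes a :: "'g::lattice_group_mult"
  shows "c * sup a b = sup (c * a) (c * b)"
proof (rule antisym)
  have "a \<le> inverse c * sup (c * a) (c * b)"
    using group_mult_left_mono[of "c * a" "sup (c * a) (c * b)" "inverse c"]
    by (simp add: group_cancel_left)
  moreover have "b \<le> inverse c * sup (c * a) (c * b)"
    using group_mult_left_mono[of "c * b" "sup (c * a) (c * b)" "inverse c"]
    by (simp add: group_cancel_left)
  ultimately have "sup a b \<le> inverse c * sup (c * a) (c * b)" by simp
  then show "c * sup a b \<le> sup (c * a) (c * b)"
    using group_mult_left_mono[of "sup a b" _ c] by (metis group_cancel_left(2))
qed (simp add: group_mult_left_mono)

lemma group_mult_Sup_fin:
  fixes A :: "'g::lattice_group_mult set"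
  assumes "finite A" "A \<noteq> {}"
  shows "c * Sup_fin A = Sup_fin ((*) c ` A)"
  using Sup_fin.hom_commute[of "(*) c", OF group_mult_sup assms] .


section \<open>Walks and balance\<close>

text \<open>Serves to cut a closed walk at a repeated tail or a repeated edge.\<close>

lemma not_distinct_map_decomp:
  "\<not> distinct (map f p) \<Longrightarrow> \<exists>q a r b s. p = q @ a # r @ b # s \<and> f a = f b"
proof (induction p)
  case (Cons c p)
  show ?case
  proof (cases "f c \<in> f ` set p")
    case True
    then obtain b r s where "f c = f b" "p = r @ b # s" by (metis imageE split_list)
    then have "c # p = [] @ c # r @ b # s \<and> f c = f b" by simp
    then show ?thesis by blast
  next
    case False
    with Cons obtain q a r b s where "p = q @ a # r @ b # s" "f a = f b" by auto
    then have "c # p = (c # q) @ a # r @ b # s \<and> f a = f b" by simp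
    then show ?thesis by blast
  qed
qed simp

context finite_gain_graph
begin

lemma head_flip: "link_or_loop \<Phi> e \<Longrightarrow> head \<Phi> (e, \<not> d) = tail \<Phi> (e, d)"
  by (cases "ends \<Phi> e") (auto simp: link_or_loop_def head_def tail_def)

lemma tail_flip: "link_or_loop \<Phi> e \<Longrightarrow> tail \<Phi> (e, \<not> d) = head \<Phi> (e, d)"
  by (cases "ends \<Phi> e") (auto simp: link_or_loop_def head_def tail_def)

lemma incident_link_or_loop:
  "link_or_loop \<Phi> (fst a) \<Longrightarrow> incident (ends \<Phi> (fst a)) = {tail \<Phi> a, head \<Phi> a}"
  by (cases "ends \<Phi> (fst a)") (auto simp: link_or_loop_def head_def tail_def)

lemma tail_head_in_verts:
  assumes "fst a \<in> edges \<Phi>" "link_or_loop \<Phi> (fst a)"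
  shows "tail \<Phi> a \<in> verts \<Phi>" "head \<Phi> a \<in> verts \<Phi>"
  using incident_verts[OF assms(1)] incident_link_or_loop[OF assms(2)] by auto

lemma gain_flip_cancel:
  assumes "e \<in> edges \<Phi>" "link_or_loop \<Phi> e"
  shows "gain \<Phi> (e, d) * gain \<Phi> (e, \<not> d) = 1"
  using gain_reverse[OF assms] by (simp add: group_right_inverse)

text \<open>For empty \<open>p\<close> the right-hand side demands that \<open>v\<close> be a
  vertex. Since \<open>walk\<close> tests membership in \<open>verts\<close> only at its last
  vertex, this comes from \<open>S\<close> consisting of edges of the graph.\<close>

lemma walk_append:
  "S \<subseteq> edges \<Phi> \<Longrightarrow> walk \<Phi> S v (p @ q) w \<longleftrightarrow> (\<exists>u. walk \<Phi> S v p u \<and> walk \<Phi> S u q w)"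
proof (induction p arbitrary: v)
  case Nil
  have "walk \<Phi> S v q w \<Longrightarrow> v \<in> verts \<Phi>"
    using tail_head_in_verts Nil by (cases q) auto
  then show ?case by auto
qed auto

lemma walk_verts:
  assumes "S \<subseteq> edges \<Phi>" "walk \<Phi> S v p w"
  shows "v \<in> verts \<Phi>" "w \<in> verts \<Phi>"
  using assms walk_append[of S v "[]" p w] walk_append[of S v p "[]" w] by auto

lemma walk_mono: "walk \<Phi> S v p w \<Longrightarrow> S \<subseteq> T \<Longrightarrow> walk \<Phi> T v p w"
  by (induction p arbitrary: v) auto

lemma walk_gain_append: "walk_gain \<Phi> (p @ q) = walk_gain \<Phi> p * walk_gain \<Phi> q"
  by (simp add: walk_gain_def)

lemma walk_gain_Cons: "walk_gain \<Phi> (a # p) = gain \<Phi> a * walk_gain \<Phi> p"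
  by (simp add: walk_gain_def)

lemma walk_gain_Nil: "walk_gain \<Phi> [] = 1"
  by (simp add: walk_gain_def)

lemma walk_reverse:
  assumes "S \<subseteq> edges \<Phi>" "walk \<Phi> S v p w"
  shows "\<exists>q. walk \<Phi> S w q v \<and> walk_gain \<Phi> p * walk_gain \<Phi> q = 1"
  using assms(2)
proof (induction p arbitrary: v)
  case Nil
  then show ?case by (metis mult_1 walk.simps(1) walk_gain_Nil)
next
  case (Cons a p)
  obtain e d where a: "a = (e, d)" by force
  from Cons.prems a have e: "e \<in> S" "link_or_loop \<Phi> e" "tail \<Phi> (e, d) = v"
    and p: "walk \<Phi> S (head \<Phi> (e, d)) p w"
    by auto
  from Cons.IH[OF p] obtain q
    where q: "walk \<Phi> S w q (head \<Phi> (e, d))" "walk_gain \<Phi> p * walk_gain \<Phi> q = 1"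
    by blast
  have "v \<in> verts \<Phi>"
    using walk_verts[OF assms(1) Cons.prems] by simp
  then have "walk \<Phi> S (head \<Phi> (e, d)) [(e, \<not> d)] v"
    using e by (simp add: head_flip tail_flip)
  then have "walk \<Phi> S w (q @ [(e, \<not> d)]) v"
    using q(1) walk_append[OF assms(1)] by blast
  moreover have "walk_gain \<Phi> (a # p) * walk_gain \<Phi> (q @ [(e, \<not> d)]) =
      gain \<Phi> (e, d) * (walk_gain \<Phi> p * walk_gain \<Phi> q) * gain \<Phi> (e, \<not> d)"
    by (simp add: a walk_gain_append walk_gain_Cons walk_gain_Nil mult.assoc)
  ultimately show ?case
    using q(2) gain_flip_cancel[of e d] e assms(1) by (metis mult_1_right subsetD)
qed

text \<open>The walk is shortened from the front: when its first vertex already lies on the path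
  found for the rest, everything before that occurrence is dropped. This ensures that the choice in
  \<open>path_gain\<close> picks an actual path.\<close>

lemma path_exists:
  assumes "S \<subseteq> edges \<Phi>" "walk \<Phi> S v p w"
  shows "\<exists>q. path \<Phi> S v q w"
  using assms(2)
proof (induction p arbitrary: v)
  case Nil
  then have "path \<Phi> S v [] w" by (auto simp: path_def)
  then show ?case ..
next
  case (Cons a p)
  then obtain q where q: "path \<Phi> S (head \<Phi> a) q w" by auto
  show ?case
  proof (cases "v \<in> set (head \<Phi> a # map (head \<Phi>) q)")
    case False
    then have "path \<Phi> S v (a # q) w"
      using q Cons.prems by (auto simp: path_def)
    then show ?thesis ..
  next
    case True
    show ?thesis
    proof (cases "v = head \<Phi> a")
      case True
      then show ?thesis using q by auto
    next
      case False
      with True obtain b where "b \<in> set q" and b: "v = head \<Phi> b" by auto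
      then obtain q1 q2 where q12: "q = (q1 @ [b]) @ q2"
        by (metis append.assoc append_Cons append_Nil split_list)
      from q obtain u where "walk \<Phi> S (head \<Phi> a) (q1 @ [b]) u" "walk \<Phi> S u q2 w"
        unfolding path_def q12 walk_append[OF assms(1)] by blast
      then have "walk \<Phi> S v q2 w"
        using walk_append[OF assms(1), of _ q1 "[b]" u] b by auto
      then have "path \<Phi> S v q2 w"
        using q b unfolding path_def q12 by auto
      then show ?thesis ..
    qed
  qed
qed

text \<open>A nonempty closed walk that is not a circle repeats a tail or an edge. In either case it
  decomposes into shorter closed walks, to which the induction on the length applies.\<close>

lemma closed_walk_gain:
  assumes "S \<subseteq> edges \<Phi>" "balanced \<Phi> S" "walk \<Phi> S v p v"
  shows "walk_gain \<Phi> p = 1"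
  using assms(3)
proof (induction "length p" arbitrary: p v rule: less_induct)
  case less
  note wapp = walk_append[OF assms(1)]
  consider "p = []" | "circle \<Phi> S p" | "\<not> distinct (map (tail \<Phi>) p)"
    | "distinct (map (tail \<Phi>) p)" "\<not> distinct (map fst p)"
    using less.prems unfolding circle_def by blast
  then show ?case
  proof cases
    case 1
    then show ?thesis by (simp add: walk_gain_Nil)
  next
    case 2
    then show ?thesis using assms(2) by (simp add: balanced_def)
  next
    \<comment> \<open>The segment between two visits to the same vertex is itself closed; removing
      it leaves a shorter closed walk.\<close>
    case 3
    then obtain q a r b s where p: "p = q @ (a # r) @ b # s" and ab: "tail \<Phi> a = tail \<Phi> b"
      using not_distinct_map_decomp[of "tail \<Phi>" p] by auto
    obtain u u' where "walk \<Phi> S v q u" "walk \<Phi> S u (a # r) u'" "walk \<Phi> S u' (b # s) v"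
      using less.prems unfolding p wapp by blast
    moreover from this have "u = u'" using ab by simp
    ultimately have "walk \<Phi> S v (q @ b # s) v" "walk \<Phi> S u (a # r) u"
      unfolding wapp by auto
    then have "walk_gain \<Phi> (q @ b # s) = 1" "walk_gain \<Phi> (a # r) = 1"
      using less.hyps by (simp_all add: p del: walk.simps)
    then show ?thesis by (simp add: p walk_gain_append del: append_Cons)
  next
    \<comment> \<open>As the tails are distinct, the repeated edge is traversed once in each
      direction. So \<open>r\<close> is closed, and so is \<open>q @ s\<close>; once
      \<open>r\<close> has gain 1, the two gains of the edge cancel.\<close>
    case 4
    then obtain q a r b s where p: "p = q @ [a] @ r @ [b] @ s" and ab: "fst a = fst b"
      using not_distinct_map_decomp[of fst p] by auto
    have "a \<noteq> b" using 4(1) by (auto simp: p)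
    with ab obtain e d where a: "a = (e, d)" and b: "b = (e, \<not> d)"
      by (cases a, cases b) auto
    obtain u1 u2 u3 u4 where w: "walk \<Phi> S v q u1" "walk \<Phi> S u1 [a] u2" "walk \<Phi> S u2 r u3"
      "walk \<Phi> S u3 [b] u4" "walk \<Phi> S u4 s v"
      using less.prems unfolding p wapp by blast
    have e: "e \<in> S" "link_or_loop \<Phi> e" using w(2) a by auto
    have "u1 = u4" "u2 = u3"
      using w(2,4) e by (auto simp: a b head_flip tail_flip)
    with w have "walk \<Phi> S v (q @ s) v" "walk \<Phi> S u2 r u2"
      unfolding wapp by auto
    then have "walk_gain \<Phi> (q @ s) = 1" "walk_gain \<Phi> r = 1"
      using less.hyps by (simp_all add: p)
    moreover have "gain \<Phi> a * gain \<Phi> b = 1"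
      using gain_flip_cancel[of e d] e assms(1) by (auto simp: a b)
    then have "gain \<Phi> a * (gain \<Phi> b * x) = x" for x
      by (simp add: mult.assoc[symmetric])
    ultimately show ?thesis
      by (simp add: p walk_gain_append walk_gain_Cons)
  qed
qed

text \<open>Following a reverse of \<open>p\<close> by \<open>q\<close> gives a closed walk, whose
  gain is 1 by balance.\<close>

lemma walk_gain_unique:
  assumes "S \<subseteq> edges \<Phi>" "balanced \<Phi> S" "walk \<Phi> S v p w" "walk \<Phi> S v q w"
  shows "walk_gain \<Phi> p = walk_gain \<Phi> q"
proof -
  obtain r where r: "walk \<Phi> S w r v" "walk_gain \<Phi> p * walk_gain \<Phi> r = 1"
    using walk_reverse[OF assms(1,3)] by blast
  have rq: "walk_gain \<Phi> r * walk_gain \<Phi> q = 1"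
    using closed_walk_gain[OF assms(1,2), of w "r @ q"] r(1) assms(4)
      walk_append[OF assms(1)] walk_gain_append by auto
  have "walk_gain \<Phi> p = walk_gain \<Phi> p * (walk_gain \<Phi> r * walk_gain \<Phi> q)"
    by (simp add: rq)
  also have "\<dots> = walk_gain \<Phi> q"
    by (simp add: mult.assoc[symmetric] r(2))
  finally show ?thesis .
qed

text \<open>The chosen path exists, and by balance it has the same gain as every walk with the same
  ends.\<close>

lemma path_gain_eq:
  assumes "S \<subseteq> edges \<Phi>" "balanced \<Phi> S" "walk \<Phi> S v p w"
  shows "path_gain \<Phi> S v w = walk_gain \<Phi> p"
proof -
  have "path \<Phi> S v (SOME p. path \<Phi> S v p w) w"
    using path_exists[OF assms(1,3)] by (rule someI_ex)
  then show ?thesis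
    unfolding path_gain_def path_def using walk_gain_unique[OF assms(1,2) _ assms(3)] by blast
qed


section \<open>Components\<close>

lemma connected_relI: "S \<subseteq> edges \<Phi> \<Longrightarrow> walk \<Phi> S v p w \<Longrightarrow> (v, w) \<in> connected_rel \<Phi> S"
  unfolding connected_rel_def using walk_verts by blast

lemma equiv_connected_rel:
  assumes "S \<subseteq> edges \<Phi>"
  shows "equiv (verts \<Phi>) (connected_rel \<Phi> S)"
proof (rule equivI)
  show "connected_rel \<Phi> S \<subseteq> verts \<Phi> \<times> verts \<Phi>"
    by (auto simp: connected_rel_def)
  show "refl_on (verts \<Phi>) (connected_rel \<Phi> S)"
    by (auto simp: refl_on_def intro!: connected_relI[OF assms, of _ "[]"])
  show "sym (connected_rel \<Phi> S)"
    unfolding sym_def connected_rel_def using walk_reverse[OF assms] by blast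
  show "trans (connected_rel \<Phi> S)"
    unfolding trans_def connected_rel_def using walk_append[OF assms] by blast
qed

lemma finite_comps: "finite (comps \<Phi> S)"
  unfolding comps_def by (rule finite_quotient[OF finite_verts]) (auto simp: connected_rel_def)

lemma comps_nonempty: "S \<subseteq> edges \<Phi> \<Longrightarrow> W \<in> comps \<Phi> S \<Longrightarrow> W \<noteq> {}"
  unfolding comps_def by (rule in_quotient_imp_non_empty[OF equiv_connected_rel])

lemma comps_subset: "S \<subseteq> edges \<Phi> \<Longrightarrow> W \<in> comps \<Phi> S \<Longrightarrow> W \<subseteq> verts \<Phi>"
  unfolding comps_def by (rule in_quotient_imp_subset[OF equiv_connected_rel])

lemma comps_eq_class:
  "S \<subseteq> edges \<Phi> \<Longrightarrow> W \<in> comps \<Phi> S \<Longrightarrow> v \<in> W \<Longrightarrow> connected_rel \<Phi> S `` {v} = W"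
  using equiv_connected_rel[of S] unfolding comps_def
  by (metis Image_singleton_iff equiv_class_eq quotientE)

lemma class_in_comps: "v \<in> verts \<Phi> \<Longrightarrow> connected_rel \<Phi> S `` {v} \<in> comps \<Phi> S"
  unfolding comps_def by (rule quotientI)

lemma in_class_self: "S \<subseteq> edges \<Phi> \<Longrightarrow> v \<in> verts \<Phi> \<Longrightarrow> v \<in> connected_rel \<Phi> S `` {v}"
  by (rule equiv_class_self[OF equiv_connected_rel])

lemma walk_comp_edges:
  assumes "S \<subseteq> edges \<Phi>" "W \<in> comps \<Phi> S"
  shows "walk \<Phi> S v p w \<Longrightarrow> v \<in> W \<Longrightarrow> walk \<Phi> (comp_edges \<Phi> S W) v p w"
proof (induction p arbitrary: v)
  case (Cons a p)
  then have a: "fst a \<in> S" "link_or_loop \<Phi> (fst a)" "tail \<Phi> a = v" by auto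
  then have "walk \<Phi> S v [a] (head \<Phi> a)"
    using tail_head_in_verts[of a] assms(1) by auto
  then have "head \<Phi> a \<in> W"
    using connected_relI[OF assms(1)] comps_eq_class[OF assms Cons.prems(2)] by blast
  then show ?case
    using Cons a incident_link_or_loop[OF a(2)] by (auto simp: comp_edges_def)
qed auto

lemma balanced_mono: "balanced \<Phi> T \<Longrightarrow> S \<subseteq> T \<Longrightarrow> balanced \<Phi> S"
  unfolding balanced_def circle_def using walk_mono by blast

text \<open>A half edge or a circle lies inside one component, so balance can be tested
  componentwise. Loose edges belong to no \<open>comp_edges\<close>, but they do not affect balance
  either.\<close>

lemma bal_comps_eq_comps_iff:
  assumes "S \<subseteq> edges \<Phi>"
  shows "bal_comps \<Phi> S = comps \<Phi> S \<longleftrightarrow> balanced \<Phi> S"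
proof
  assume *: "bal_comps \<Phi> S = comps \<Phi> S"
  then have bal: "balanced \<Phi> (comp_edges \<Phi> S (connected_rel \<Phi> S `` {v}))" if "v \<in> verts \<Phi>" for v
    using class_in_comps[OF that, of S] unfolding bal_comps_def by blast
  show "balanced \<Phi> S"
    unfolding balanced_def
  proof (intro conjI ballI allI impI notI)
    fix e assume e: "e \<in> S" "is_Half (ends \<Phi> e)"
    then obtain v where v: "ends \<Phi> e = Half v" by (cases "ends \<Phi> e") auto
    have "v \<in> verts \<Phi>" using incident_verts[of e] e v assms by auto
    moreover from this have "e \<in> comp_edges \<Phi> S (connected_rel \<Phi> S `` {v})"
      using e v in_class_self[OF assms] by (auto simp: comp_edges_def)
    ultimately show False using bal e(2) unfolding balanced_def by blast
  next
    fix p assume p: "circle \<Phi> S p"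
    then obtain v where v: "walk \<Phi> S v p v" unfolding circle_def by blast
    note vv = walk_verts(1)[OF assms v]
    have "walk \<Phi> (comp_edges \<Phi> S (connected_rel \<Phi> S `` {v})) v p v"
      using walk_comp_edges[OF assms class_in_comps[OF vv] v in_class_self[OF assms vv]] .
    then have "circle \<Phi> (comp_edges \<Phi> S (connected_rel \<Phi> S `` {v})) p"
      using p unfolding circle_def by blast
    then show "walk_gain \<Phi> p = 1" using bal[OF vv] unfolding balanced_def by blast
  qed
next
  assume "balanced \<Phi> S"
  then have "balanced \<Phi> (comp_edges \<Phi> S W)" for W
    by (rule balanced_mono) (auto simp: comp_edges_def)
  then show "bal_comps \<Phi> S = comps \<Phi> S" by (auto simp: bal_comps_def)
qed

text \<open>Decides which terms survive at z = 0: there the power of z is 1 if its exponent vanishes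
  and 0 otherwise.\<close>

lemma num_comps_eq_iff_balanced:
  assumes "S \<subseteq> edges \<Phi>"
  shows "num_comps \<Phi> S - num_bal_comps \<Phi> S = 0 \<longleftrightarrow> balanced \<Phi> S"
proof -
  have "bal_comps \<Phi> S \<subseteq> comps \<Phi> S" by (auto simp: bal_comps_def)
  then have "num_comps \<Phi> S - num_bal_comps \<Phi> S = 0 \<longleftrightarrow> bal_comps \<Phi> S = comps \<Phi> S"
    unfolding num_comps_def num_bal_comps_def
    by (metis card_seteq diff_is_0_eq finite_comps order_refl)
  then show ?thesis using bal_comps_eq_comps_iff[OF assms] by simp
qed

section \<open>The bound on the number of vertices by edges and components\<close>

lemma connected_rel_insert:
  assumes "insert e S \<subseteq> edges \<Phi>" "walk \<Phi> (insert e S) v p w"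
  shows "(v, w) \<in> connected_rel \<Phi> S \<or>
    (\<exists>d. (v, tail \<Phi> (e, d)) \<in> connected_rel \<Phi> S \<and> (head \<Phi> (e, d), w) \<in> connected_rel \<Phi> S)"
  using assms(2)
proof (induction p arbitrary: v)
  case Nil
  then have "walk \<Phi> S v [] w" by auto
  then show ?case using connected_relI[of S] assms(1) by blast
next
  case (Cons a p)
  have S: "S \<subseteq> edges \<Phi>" using assms(1) by simp
  note eq = equiv_connected_rel[OF S]
  have tr: "(x, z) \<in> connected_rel \<Phi> S"
    if "(x, y) \<in> connected_rel \<Phi> S" "(y, z) \<in> connected_rel \<Phi> S" for x y z
    using that eq by (meson equivE transE)
  have rf: "(x, x) \<in> connected_rel \<Phi> S" if "x \<in> verts \<Phi>" for x
    using that eq by (meson equivE refl_onD)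
  from Cons.prems have a: "fst a \<in> insert e S" "link_or_loop \<Phi> (fst a)" "tail \<Phi> a = v"
    and p: "walk \<Phi> (insert e S) (head \<Phi> a) p w" by auto
  note vh = tail_head_in_verts[of a]
  note IH = Cons.IH[OF p]
  show ?case
  proof (cases "fst a \<in> S")
    case True
    then have "walk \<Phi> S v [a] (head \<Phi> a)"
      using a vh S by auto
    then have "(v, head \<Phi> a) \<in> connected_rel \<Phi> S"
      using connected_relI[OF S] by blast
    then show ?thesis using IH tr by blast
  next
    case False
    then obtain d where a': "a = (e, d)" using a(1) by (cases a) auto
    have v: "v \<in> verts \<Phi>" using vh a a' assms(1) by auto
    from IH show ?thesis
    proof (elim disjE exE conjE)
      assume "(head \<Phi> a, w) \<in> connected_rel \<Phi> S"
      then show ?thesis using rf[OF v] a a' by auto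
    next
      fix d' assume d': "(head \<Phi> a, tail \<Phi> (e, d')) \<in> connected_rel \<Phi> S"
        "(head \<Phi> (e, d'), w) \<in> connected_rel \<Phi> S"
      \<comment> \<open>If \<open>e\<close> is crossed again in the same direction, the part between
        the two crossings is skipped and one crossing is left. If it is crossed in the opposite
        direction, the second crossing leads back to \<open>v\<close>, and both are dropped.\<close>
      show ?thesis
      proof (cases "d' = d")
        case True
        then show ?thesis using d' rf[OF v] a a' by auto
      next
        case False
        then have "d' = (\<not> d)" by auto
        then have "head \<Phi> (e, d') = v" using a a' head_flip by auto
        then show ?thesis using d' by blast
      qed
    qed
  qed
qed

text \<open>An added edge merges at most two components. Hence the map from each old component to
  the new one containing it becomes injective once the component \<open>?U\<close> of one end of
  \<open>e\<close> is left out.\<close>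

lemma num_comps_insert:
  assumes "insert e S \<subseteq> edges \<Phi>"
  shows "num_comps \<Phi> S \<le> Suc (num_comps \<Phi> (insert e S))"
proof -
  have S: "S \<subseteq> edges \<Phi>" using assms by simp
  let ?R = "connected_rel \<Phi> S" and ?R' = "connected_rel \<Phi> (insert e S)"
  note eq = equiv_connected_rel[OF S] and eq' = equiv_connected_rel[OF assms]
  let ?U = "?R `` {tail \<Phi> (e, True)}"
  have "?R \<subseteq> ?R'"
    unfolding connected_rel_def using walk_mono[of S _ _ _ "insert e S"] by blast
  then have img: "?R' `` W \<in> comps \<Phi> (insert e S)" if "W \<in> comps \<Phi> S" for W
    using refines_equiv_image_eq[OF _ eq eq'] that unfolding comps_def by blast
  have "inj_on (\<lambda>W. ?R' `` W) (comps \<Phi> S - {?U})"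
  proof (rule inj_onI)
    fix A B assume A: "A \<in> comps \<Phi> S - {?U}" and B: "B \<in> comps \<Phi> S - {?U}"
      and AB: "?R' `` A = ?R' `` B"
    obtain a b where a: "A = ?R `` {a}" "a \<in> verts \<Phi>" and b: "B = ?R `` {b}" "b \<in> verts \<Phi>"
      using A B unfolding comps_def by (auto elim!: quotientE)
    have "?R' `` {a} = ?R' `` {b}"
      using AB refines_equiv_class_eq2[OF \<open>?R \<subseteq> ?R'\<close> eq eq'] unfolding a b by simp
    then have "(a, b) \<in> ?R'"
      using eq_equiv_class[OF _ eq'] b by blast
    then obtain p where p: "walk \<Phi> (insert e S) a p b" unfolding connected_rel_def by blast
    have na: "(a, tail \<Phi> (e, True)) \<notin> ?R" "(tail \<Phi> (e, True), b) \<notin> ?R"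
      using A B equiv_class_eq[OF eq] unfolding a b by blast+
    have "(a, b) \<in> ?R"
    proof (rule ccontr)
      assume "(a, b) \<notin> ?R"
      \<comment> \<open>A connection that is new must cross \<open>e\<close>. Crossing forwards
        would start at the end in \<open>?U\<close>, crossing backwards would finish there, and
        neither \<open>a\<close> nor \<open>b\<close> is connected to that end.\<close>
      then obtain d where d: "(a, tail \<Phi> (e, d)) \<in> ?R" "(head \<Phi> (e, d), b) \<in> ?R"
        using connected_rel_insert[OF assms p] by blast
      with na have "d = False" by (cases d) auto
      moreover have "head \<Phi> (e, False) = tail \<Phi> (e, True)"
        by (cases "ends \<Phi> e") (auto simp: head_def tail_def)
      ultimately show False using d na by simp
    qed
    then show "A = B" using equiv_class_eq[OF eq] a b by blast
  qed
  then have "card (comps \<Phi> S - {?U}) \<le> card (comps \<Phi> (insert e S))"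
    by (rule card_inj_on_le) (use img finite_comps in auto)
  \<comment> \<open>For a loose edge \<open>tail\<close> is \<open>undefined\<close>, so
    \<open>?U\<close> need not be a component; then nothing is removed.\<close>
  moreover have "card (comps \<Phi> S) \<le> Suc (card (comps \<Phi> S - {?U}))"
    using card_Suc_Diff1[OF finite_comps] by (cases "?U \<in> comps \<Phi> S") (auto simp: Diff_insert0)
  ultimately show ?thesis unfolding num_comps_def by linarith
qed

text \<open>The edges are added one at a time, starting from isolated vertices. For balanced
  \<open>S\<close>, where all components are balanced, this shows that the exponent of v does not
  truncate.\<close>

lemma card_verts_le:
  assumes "S \<subseteq> edges \<Phi>"
  shows "card (verts \<Phi>) \<le> card S + num_comps \<Phi> S"
  using finite_subset[OF assms finite_edges] assms
proof (induction S rule: finite_induct)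
  case empty
  have "connected_rel \<Phi> {} `` {v} = {v}" if "v \<in> verts \<Phi>" for v
  proof -
    have "walk \<Phi> {} v p w \<Longrightarrow> w = v" for p w by (cases p) auto
    then show ?thesis using in_class_self[of "{}" v] that by (auto simp: connected_rel_def)
  qed
  then have "comps \<Phi> {} = (\<lambda>v. {v}) ` verts \<Phi>"
    unfolding comps_def quotient_def by auto
  then show ?case by (simp add: num_comps_def card_image)
next
  case (insert e S)
  then show ?case using num_comps_insert[of e S] by simp
qed

text \<open>Prefixing \<open>p\<close> turns walks from \<open>w\<close> into walks from
  \<open>v\<close>, so the set of path gains at \<open>v\<close> is the left translate by
  \<open>walk_gain \<Phi> p\<close> of the set at \<open>w\<close>. Left multiplication then passes
  through the finite join.\<close>

lemma eta_shift:
  assumes "S \<subseteq> edges \<Phi>" "balanced \<Phi> S" "walk \<Phi> S v p w"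
  shows "eta \<Phi> S v = walk_gain \<Phi> p * eta \<Phi> S w"
proof -
  let ?R = "connected_rel \<Phi> S"
  have R: "?R `` {v} = ?R `` {w}"
    using equiv_class_eq[OF equiv_connected_rel[OF assms(1)] connected_relI[OF assms(1,3)]] .
  have "path_gain \<Phi> S v u = walk_gain \<Phi> p * path_gain \<Phi> S w u" if "u \<in> ?R `` {w}" for u
  proof -
    from that obtain q where q: "walk \<Phi> S w q u" unfolding connected_rel_def by blast
    then have "walk \<Phi> S v (p @ q) u" using assms(3) walk_append[OF assms(1)] by blast
    then show ?thesis
      using q path_gain_eq[OF assms(1,2)] by (metis walk_gain_append)
  qed
  then have "path_gain \<Phi> S v ` (?R `` {v}) = (*) (walk_gain \<Phi> p) ` path_gain \<Phi> S w ` (?R `` {w})"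
    unfolding R image_image by (intro image_cong) auto
  moreover have "finite (?R `` {w})"
    by (rule finite_subset[OF _ finite_verts]) (auto simp: connected_rel_def)
  moreover have "?R `` {w} \<noteq> {}"
    using in_class_self[OF assms(1)] walk_verts[OF assms(1,3)] by blast
  ultimately show ?thesis
    unfolding eta_def by (subst group_mult_Sup_fin) auto
qed

end


section \<open>Improper colorings\<close>

context color_action
begin

lemma act_cancel:
  assumes "x \<in> C"
  shows "act (act x g) (inverse g) = x" "act (act x (inverse g)) g = x"
  using act_mult[OF assms, symmetric] act_one[OF assms]
  by (simp_all add: group_left_inverse group_right_inverse)

text \<open>Translation by \<open>g\<close> is inverted on \<open>C\<close> by translation by
  \<open>inverse g\<close>; the action laws hold on \<open>C\<close> only, hence the assumption on
  \<open>A\<close>.\<close>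

lemma mem_set_act_iff:
  assumes "A \<subseteq> C"
  shows "c \<in> set_act act A g \<longleftrightarrow> c \<in> C \<and> act c (inverse g) \<in> A"
proof
  assume "c \<in> set_act act A g"
  then show "c \<in> C \<and> act c (inverse g) \<in> A"
    using assms act_closed act_cancel by (auto simp: set_act_def)
next
  assume "c \<in> C \<and> act c (inverse g) \<in> A"
  then show "c \<in> set_act act A g"
    using act_cancel(2)[of c g] unfolding set_act_def by (metis image_eqI)
qed

end

section \<open>Counting the colorings improper on every edge of a given set\<close>

locale list_weighted_gain_graph = finite_gain_graph \<Phi> + list_class C act \<WW>
  for \<Phi> :: "('v, 'e, 'g::lattice_group_mult) gain_graph"
    and C :: "'c set" and act :: "'c \<Rightarrow> 'g \<Rightarrow> 'c" and \<WW> :: "'c set set" +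
  fixes h M :: "'v \<Rightarrow> 'c set"
  assumes h_lists: "v \<in> verts \<Phi> \<Longrightarrow> h v \<in> \<WW>"
    and M_subset: "v \<in> verts \<Phi> \<Longrightarrow> M v \<subseteq> C"
    and finite_M_h: "v \<in> verts \<Phi> \<Longrightarrow> finite (M v \<inter> h v)"
begin

definition colorings :: "('v \<Rightarrow> 'c) set" where
  "colorings = (\<Pi>\<^sub>E v\<in>verts \<Phi>. h v \<inter> M v)"

definition improper_colorings :: "'e set \<Rightarrow> ('v \<Rightarrow> 'c) set" where
  "improper_colorings S = {x \<in> colorings. \<forall>e\<in>S. \<not> proper_edge \<Phi> act x e}"

lemma finite_colorings: "finite colorings"
  unfolding colorings_def using finite_M_h by (intro finite_PiE finite_verts) (simp add: Int_commute)

lemma coloring_in_C: "x \<in> colorings \<Longrightarrow> v \<in> verts \<Phi> \<Longrightarrow> x v \<in> C"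
  unfolding colorings_def using M_subset by blast

text \<open>Acting with the inverse gain turns the equation for one orientation into that for the
  other, so either may be tested.\<close>

lemma improper_edge_iff:
  assumes "x \<in> colorings" "e \<in> edges \<Phi>" "link_or_loop \<Phi> e"
  shows "\<not> proper_edge \<Phi> act x e \<longleftrightarrow>
    x (head \<Phi> (e, d)) = act (x (tail \<Phi> (e, d))) (gain \<Phi> (e, d))"
proof -
  have flip: "x (head \<Phi> (e, \<not> d)) = act (x (tail \<Phi> (e, \<not> d))) (gain \<Phi> (e, \<not> d))"
    if "x (head \<Phi> (e, d)) = act (x (tail \<Phi> (e, d))) (gain \<Phi> (e, d))" for d
    using that tail_head_in_verts[of "(e, d)"] assms coloring_in_C[OF assms(1)]
    by (simp add: head_flip tail_flip gain_reverse act_cancel)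
  have "\<not> is_Loose (ends \<Phi> e)"
    using assms(3) by (cases "ends \<Phi> e") (auto simp: link_or_loop_def)
  then have "\<not> proper_edge \<Phi> act x e \<longleftrightarrow>
      (\<exists>d. x (head \<Phi> (e, d)) = act (x (tail \<Phi> (e, d))) (gain \<Phi> (e, d)))"
    using assms(3) unfolding proper_edge_def by blast
  then show ?thesis using flip[of True] flip[of False] by (cases d) (auto simp: ex_bool_eq)
qed

lemma improper_walk:
  assumes "S \<subseteq> edges \<Phi>" "x \<in> improper_colorings S"
  shows "walk \<Phi> S v p w \<Longrightarrow> x w = act (x v) (walk_gain \<Phi> p)"
proof (induction p arbitrary: v)
  case Nil
  then show ?case
    using act_one coloring_in_C assms(2) by (auto simp: improper_colorings_def walk_gain_Nil)
next
  case (Cons a p)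
  then have a: "fst a \<in> S" "link_or_loop \<Phi> (fst a)" "tail \<Phi> a = v"
    and w: "x w = act (x (head \<Phi> a)) (walk_gain \<Phi> p)" by auto
  have "x (head \<Phi> a) = act (x v) (gain \<Phi> a)"
    using improper_edge_iff[of x "fst a" "snd a"] a assms by (auto simp: improper_colorings_def)
  moreover have "x v \<in> C"
    using coloring_in_C walk_verts(1)[OF assms(1) Cons.prems] assms(2)
    by (auto simp: improper_colorings_def)
  ultimately show ?case using w by (simp add: walk_gain_Cons act_mult)
qed

text \<open>Half edges are always proper, so \<open>S\<close> has none if such a coloring exists.
  Around a circle the color of the starting vertex is fixed by the gain of the circle, which is
  therefore 1.\<close>

lemma improper_colorings_unbalanced:
  assumes "S \<subseteq> edges \<Phi>" "\<not> balanced \<Phi> S"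
  shows "improper_colorings S = {}"
proof (rule ccontr)
  assume "improper_colorings S \<noteq> {}"
  then obtain x where x: "x \<in> improper_colorings S" by blast
  have "balanced \<Phi> S"
    unfolding balanced_def
  proof (intro conjI ballI allI impI notI)
    fix e assume e: "e \<in> S" "is_Half (ends \<Phi> e)"
    then have "proper_edge \<Phi> act x e"
      by (cases "ends \<Phi> e") (auto simp: proper_edge_def link_or_loop_def)
    then show False using x e by (auto simp: improper_colorings_def)
  next
    fix p assume "circle \<Phi> S p"
    then obtain v where v: "walk \<Phi> S v p v" unfolding circle_def by blast
    have "x v \<in> C"
      using coloring_in_C walk_verts(1)[OF assms(1) v] x by (auto simp: improper_colorings_def)
    then show "walk_gain \<Phi> p = 1"
      using improper_walk[OF assms(1) x v] act_fixed_point_free by metis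
  qed
  then show False using assms(2) by blast
qed

text \<open>That \<open>W\<close> is nonempty matters here: an empty intersection would be the whole
  type instead of a subset of \<open>C\<close>.\<close>

lemma mem_contract_Int_iff:
  assumes "S \<subseteq> edges \<Phi>" "W \<in> comps \<Phi> S"
  shows "c \<in> contract \<Phi> act h S W \<inter> contract \<Phi> act M S W \<longleftrightarrow>
    c \<in> C \<and> (\<forall>v\<in>W. act c (inverse (eta \<Phi> S v)) \<in> h v \<inter> M v)"
proof -
  have "h v \<subseteq> C" "M v \<subseteq> C" if "v \<in> W" for v
    using that comps_subset[OF assms] h_lists lists_subset M_subset by blast+
  then show ?thesis
    using comps_nonempty[OF assms] mem_set_act_iff unfolding contract_def by auto
qed

text \<open>The values of the indeterminates are prescribed only on \<open>M0\<close>. Closure of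
  the lists under binary intersection suffices because \<open>W\<close> is finite and nonempty, and
  finiteness holds because one translate of \<open>M v \<inter> h v\<close> contains the whole
  intersection.\<close>

lemma contract_in_M0:
  assumes "S \<subseteq> edges \<Phi>" "W \<in> comps \<Phi> S"
  shows "(contract \<Phi> act h S W, contract \<Phi> act M S W) \<in> M0 C \<WW>"
proof -
  have fin: "finite W" using comps_subset[OF assms] finite_verts finite_subset by blast
  have lists: "(\<Inter>v\<in>U. set_act act (h v) (eta \<Phi> S v)) \<in> \<WW>"
    if "finite U" "U \<noteq> {}" "U \<subseteq> verts \<Phi>" for U
    using that
  proof (induction U rule: finite_ne_induct)
    case (singleton v)
    then show ?case using lists_act h_lists by simp
  next
    case (insert v U)
    then show ?case using lists_act h_lists lists_Int by simp
  qed
  obtain v where v: "v \<in> W" "v \<in> verts \<Phi>"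
    using comps_nonempty[OF assms] comps_subset[OF assms] by blast
  have "contract \<Phi> act M S W \<subseteq> set_act act (M v) (eta \<Phi> S v)"
    using v by (auto simp: contract_def)
  then have "contract \<Phi> act M S W \<subseteq> C"
    using mem_set_act_iff[OF M_subset[OF v(2)]] by blast
  moreover have "contract \<Phi> act h S W \<inter> contract \<Phi> act M S W \<subseteq>
      set_act act (M v \<inter> h v) (eta \<Phi> S v)"
  proof
    fix c assume "c \<in> contract \<Phi> act h S W \<inter> contract \<Phi> act M S W"
    then show "c \<in> set_act act (M v \<inter> h v) (eta \<Phi> S v)"
      using v M_subset[OF v(2)] unfolding mem_contract_Int_iff[OF assms]
      by (subst mem_set_act_iff) auto
  qed
  then have "finite (contract \<Phi> act M S W \<inter> contract \<Phi> act h S W)"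
    using finite_M_h[OF v(2)] unfolding set_act_def
    by (metis Int_commute finite_imageI finite_subset)
  ultimately show ?thesis
    using lists[OF fin comps_nonempty[OF assms] comps_subset[OF assms]]
    by (simp add: M0_def contract_def)
qed

lemma card_improper_colorings:
  assumes S: "S \<subseteq> edges \<Phi>" and bal: "balanced \<Phi> S"
  shows "card (improper_colorings S) =
    (\<Prod>W\<in>comps \<Phi> S. card (contract \<Phi> act M S W \<inter> contract \<Phi> act h S W))"
proof -
  let ?R = "connected_rel \<Phi> S" and ?\<eta> = "eta \<Phi> S"
  let ?K = "\<lambda>W. contract \<Phi> act h S W \<inter> contract \<Phi> act M S W"
  \<comment> \<open>\<open>F\<close> records one normalized color per component, read at an
    arbitrary vertex; \<open>G\<close> recovers the color of \<open>v\<close> by undoing the action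
    of \<open>eta \<Phi> S v\<close>. Both are \<open>undefined\<close> outside their domains, as
    membership in \<open>PiE\<close> requires.\<close>
  define F where "F x = (\<lambda>W\<in>comps \<Phi> S. let v = (SOME v. v \<in> W) in act (x v) (?\<eta> v))" for x
  define G where "G c = (\<lambda>v\<in>verts \<Phi>. act (c (?R `` {v})) (inverse (?\<eta> v)))" for c :: "'v set \<Rightarrow> 'c"
  \<comment> \<open>The normalized color is the same at all vertices of \<open>W\<close>: moving
    along a walk multiplies the color by the gain, which \<open>eta_shift\<close>
    compensates.\<close>
  have F: "F x W = act (x v) (?\<eta> v)"
    if x: "x \<in> improper_colorings S" and W: "W \<in> comps \<Phi> S" and v: "v \<in> W" for x W v
  proof -
    define w where "w = (SOME v. v \<in> W)"
    have "w \<in> W" unfolding w_def using v by (rule someI)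
    then have "(v, w) \<in> ?R" using comps_eq_class[OF S W v] by auto
    then obtain p where p: "walk \<Phi> S v p w" unfolding connected_rel_def by blast
    have "x v \<in> C"
      using x v comps_subset[OF S W] coloring_in_C unfolding improper_colorings_def by blast
    then have "act (x w) (?\<eta> w) = act (x v) (?\<eta> v)"
      by (simp add: improper_walk[OF S x p] eta_shift[OF S bal p] act_mult)
    then show ?thesis using W by (simp add: F_def w_def Let_def)
  qed
  have K: "c W \<in> C" "v \<in> W \<Longrightarrow> act (c W) (inverse (?\<eta> v)) \<in> h v \<inter> M v"
    if "c \<in> PiE (comps \<Phi> S) ?K" "W \<in> comps \<Phi> S" for c W v
    using that mem_contract_Int_iff[OF S that(2), of "c W"] by (auto dest: PiE_mem)
  have "bij_betw F (improper_colorings S) (PiE (comps \<Phi> S) ?K)"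
  proof (rule bij_betw_byWitness[where f' = G])
    show "\<forall>x\<in>improper_colorings S. G (F x) = x"
    proof
      fix x assume x: "x \<in> improper_colorings S"
      then have col: "x \<in> colorings" by (simp add: improper_colorings_def)
      show "G (F x) = x"
      proof
        fix v show "G (F x) v = x v"
        proof (cases "v \<in> verts \<Phi>")
          case True
          then show ?thesis
            using F[OF x class_in_comps[OF True] in_class_self[OF S True]] coloring_in_C[OF col]
            by (simp add: G_def act_cancel)
        next
          case False
          then show ?thesis using col by (auto simp: G_def colorings_def)
        qed
      qed
    qed
  next
    have GK: "G c \<in> improper_colorings S" if c: "c \<in> PiE (comps \<Phi> S) ?K" for c
    proof -
      have col: "G c \<in> colorings"
        unfolding colorings_def using K(2)[OF c class_in_comps in_class_self[OF S]]
        by (auto simp: G_def)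
      have "\<not> proper_edge \<Phi> act (G c) e" if e: "e \<in> S" for e
      proof (cases "link_or_loop \<Phi> e")
        case True
        let ?t = "tail \<Phi> (e, True)" and ?h = "head \<Phi> (e, True)" and ?g = "gain \<Phi> (e, True)"
        have th: "?t \<in> verts \<Phi>" "?h \<in> verts \<Phi>"
          using tail_head_in_verts[of "(e, True)"] e S True by auto
        then have w: "walk \<Phi> S ?t [(e, True)] ?h" using e True by simp
        have cls: "?R `` {?t} = ?R `` {?h}"
          using equiv_class_eq[OF equiv_connected_rel[OF S] connected_relI[OF S w]] .
        \<comment> \<open>Applying \<open>eta_shift\<close> to the walk consisting of this one edge
          makes the colors at its two ends differ exactly by its gain.\<close>
        have \<eta>: "?\<eta> ?t = ?g * ?\<eta> ?h"
          using eta_shift[OF S bal w] by (simp add: walk_gain_Cons walk_gain_Nil)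
        have inv: "inverse (?\<eta> ?t) * ?g = inverse (?\<eta> ?h)"
          using group_cancel_left(1)[of "?\<eta> ?t" "inverse (?\<eta> ?h)"]
          by (simp add: \<eta> mult.assoc group_right_inverse)
        have "act (G c ?t) ?g = act (c (?R `` {?t})) (inverse (?\<eta> ?t) * ?g)"
          using th K(1)[OF c class_in_comps] by (simp add: G_def act_mult)
        also have "\<dots> = G c ?h" using th cls inv by (simp add: G_def)
        finally show ?thesis using improper_edge_iff[OF col, of e True] True e S by auto
      next
        \<comment> \<open>Half edges are excluded by balance; what is left is a loose edge, which is
          improper for every coloring.\<close>
        case False
        moreover have "\<not> is_Half (ends \<Phi> e)" using bal e by (auto simp: balanced_def)
        ultimately have "is_Loose (ends \<Phi> e)"
          by (cases "ends \<Phi> e") (auto simp: link_or_loop_def)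
        then show ?thesis by (simp add: proper_edge_def)
      qed
      then show ?thesis using col by (simp add: improper_colorings_def)
    qed
    show "\<forall>c\<in>PiE (comps \<Phi> S) ?K. F (G c) = c"
    proof
      fix c assume c: "c \<in> PiE (comps \<Phi> S) ?K"
      show "F (G c) = c"
      proof
        fix W show "F (G c) W = c W"
        proof (cases "W \<in> comps \<Phi> S")
          case W: True
          then obtain v where v: "v \<in> W" using comps_nonempty[OF S] by blast
          then have "v \<in> verts \<Phi>" using comps_subset[OF S W] by blast
          then show ?thesis
            using F[OF GK[OF c] W v] K(1)[OF c W] comps_eq_class[OF S W v]
            by (simp add: G_def act_cancel)
        next
          case False
          then show ?thesis using c by (auto simp: F_def)
        qed
      qed
    qed
    show "G ` PiE (comps \<Phi> S) ?K \<subseteq> improper_colorings S" using GK by blast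
    show "F ` improper_colorings S \<subseteq> PiE (comps \<Phi> S) ?K"
    proof (intro image_subsetI PiE_I)
      fix x W assume x: "x \<in> improper_colorings S" and W: "W \<in> comps \<Phi> S"
      have xW: "x v \<in> C" "x v \<in> h v \<inter> M v" if "v \<in> W" for v
        using x that comps_subset[OF S W] coloring_in_C
        unfolding improper_colorings_def colorings_def by blast+
      obtain w where w: "w \<in> W" using comps_nonempty[OF S W] by blast
      have "F x W \<in> C" using F[OF x W w] act_closed xW(1)[OF w] by simp
      moreover have "act (F x W) (inverse (?\<eta> v)) \<in> h v \<inter> M v" if "v \<in> W" for v
        using F[OF x W that] xW[OF that] act_cancel by simp
      ultimately show "F x W \<in> ?K W" using mem_contract_Int_iff[OF S W] by blast
    next
      fix x W assume "W \<notin> comps \<Phi> S"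
      then show "F x W = undefined" by (simp add: F_def)
    qed
  qed
  then have "card (improper_colorings S) = card (PiE (comps \<Phi> S) ?K)"
    by (rule bij_betw_same_card)
  then show ?thesis by (simp add: card_PiE finite_comps Int_commute)
qed

text \<open>The indicator of a proper coloring is the product over all edges of 1 minus the
  indicator of impropriety. Expanding it over subsets of edges and exchanging the two finite sums
  gives the formula.\<close>

lemma list_chromatic_inclusion_exclusion:
  "int (list_chromatic \<Phi> act h M) =
    (\<Sum>S\<in>Pow (edges \<Phi>). (-1) ^ card S * int (card (improper_colorings S)))"
proof -
  have of_bool_Ball: "(\<Prod>e\<in>S. of_bool (P e)) = (of_bool (\<forall>e\<in>S. P e) :: int)"
    if "finite S" for S :: "'e set" and P
    using that by (induction S rule: finite_induct) auto
  have count: "int (card {x \<in> colorings. P x}) = (\<Sum>x\<in>colorings. of_bool (P x))" for P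
    using finite_colorings by (simp add: sum.If_cases of_bool_def Int_def)
  have "int (list_chromatic \<Phi> act h M) =
      (\<Sum>x\<in>colorings. of_bool (\<forall>e\<in>edges \<Phi>. proper_edge \<Phi> act x e))"
    unfolding list_chromatic_def colorings_def[symmetric] by (rule count)
  also have "\<dots> = (\<Sum>x\<in>colorings. \<Prod>e\<in>edges \<Phi>. 1 - of_bool (\<not> proper_edge \<Phi> act x e))"
    by (simp add: of_bool_Ball finite_edges of_bool_not_iff)
  also have "\<dots> = (\<Sum>x\<in>colorings. \<Sum>S\<in>Pow (edges \<Phi>).
      (-1) ^ card S * of_bool (\<forall>e\<in>S. \<not> proper_edge \<Phi> act x e))"
    by (intro sum.cong refl, subst prod_diff_conv_sum[OF finite_edges], intro sum.cong refl)
      (use of_bool_Ball finite_subset[OF _ finite_edges] in auto)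
  also have "\<dots> = (\<Sum>S\<in>Pow (edges \<Phi>). \<Sum>x\<in>colorings.
      (-1) ^ card S * of_bool (\<forall>e\<in>S. \<not> proper_edge \<Phi> act x e))"
    by (rule sum.swap)
  also have "\<dots> = (\<Sum>S\<in>Pow (edges \<Phi>). (-1) ^ card S * int (card (improper_colorings S)))"
    unfolding improper_colorings_def count sum_distrib_left ..
  finally show ?thesis .
qed

end


section \<open>Comparison of the two expansions term by term\<close>

theorem theorem5p8:
  fixes \<Phi> :: "('v, 'e, 'g::lattice_group_mult) gain_graph"
    and C :: "'c set"
    and act :: "'c \<Rightarrow> 'g \<Rightarrow> 'c"
    and \<WW> :: "'c set set"
    and h M :: "'v \<Rightarrow> 'c set"
    and \<sigma> :: "'c dichromatic_indet \<Rightarrow> int"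
  assumes "finite_gain_graph \<Phi>"
    and "list_class C act \<WW>"
    and "\<And>v. v \<in> verts \<Phi> \<Longrightarrow> h v \<in> \<WW>"
    and "\<And>v. v \<in> verts \<Phi> \<Longrightarrow> M v \<subseteq> C"
    and "\<And>v. v \<in> verts \<Phi> \<Longrightarrow> finite (M v \<inter> h v)"
    and "\<And>h' M'. (h', M') \<in> M0 C \<WW> \<Longrightarrow> \<sigma> (Ind_u h' M') = - int (card (M' \<inter> h'))"
    and "\<sigma> Ind_v = -1"
    and "\<sigma> Ind_z = 0"
  shows "int (list_chromatic \<Phi> act h M) =
    (-1) ^ card (verts \<Phi>) * eval_mpoly \<sigma> (total_dichromatic \<Phi> act h M)"
proof -
  interpret list_weighted_gain_graph \<Phi> C act \<WW> h M
    using assms(1-5)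
    by (intro list_weighted_gain_graph.intro list_weighted_gain_graph_axioms.intro)
  let ?n = "card (verts \<Phi>)"
  have "(-1) ^ ?n * ((-1) ^ (card S + num_bal_comps \<Phi> S - ?n) *
        0 ^ (num_comps \<Phi> S - num_bal_comps \<Phi> S) *
        (\<Prod>W\<in>bal_comps \<Phi> S. \<sigma> (Ind_u (contract \<Phi> act h S W) (contract \<Phi> act M S W)))) =
      (-1) ^ card S * int (card (improper_colorings S))" if S: "S \<subseteq> edges \<Phi>" for S
  proof (cases "balanced \<Phi> S")
    case False
    \<comment> \<open>Both sides vanish: the exponent of z is positive, and no coloring is improper
      on all of \<open>S\<close>.\<close>
    then show ?thesis
      using num_comps_eq_iff_balanced[OF S] improper_colorings_unbalanced[OF S] by simp
  next
    case True
    let ?b = "num_comps \<Phi> S"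
    let ?P = "\<Prod>W\<in>comps \<Phi> S. int (card (contract \<Phi> act M S W \<inter> contract \<Phi> act h S W))"
    have bc: "bal_comps \<Phi> S = comps \<Phi> S" using True bal_comps_eq_comps_iff[OF S] by simp
    then have b: "num_bal_comps \<Phi> S = ?b" by (simp add: num_bal_comps_def num_comps_def)
    \<comment> \<open>Each component contributes one minus sign from the substituted value,
      (-1)^c(S) in total.\<close>
    have "(\<Prod>W\<in>comps \<Phi> S. \<sigma> (Ind_u (contract \<Phi> act h S W) (contract \<Phi> act M S W))) =
        (\<Prod>W\<in>comps \<Phi> S. - int (card (contract \<Phi> act M S W \<inter> contract \<Phi> act h S W)))"
      by (intro prod.cong refl assms(6) contract_in_M0[OF S])
    also have "\<dots> = (-1) ^ ?b * ?P"
      by (simp add: prod_uminus num_comps_def)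
    finally have u: "(\<Prod>W\<in>comps \<Phi> S. \<sigma> (Ind_u (contract \<Phi> act h S W) (contract \<Phi> act M S W))) =
        (-1) ^ ?b * ?P" .
    \<comment> \<open>By \<open>card_verts_le\<close> the subtraction is exact, so the factor (-1)^n
      restores the full exponent |S| + c(S). The c(S) part then cancels against the signs from the
      components.\<close>
    have "(-1 :: int) ^ ?n * (-1) ^ (card S + ?b - ?n) = (-1) ^ (card S + ?b)"
      using card_verts_le[OF S] by (simp add: power_add[symmetric])
    then have "(-1 :: int) ^ ?n * ((-1) ^ (card S + ?b - ?n) * ((-1) ^ ?b * ?P)) =
        (-1) ^ (card S + ?b) * (-1) ^ ?b * ?P"
      by (simp add: mult.assoc[symmetric])
    also have "\<dots> = (-1) ^ card S * ?P"
      by (simp add: power_add mult.assoc power_mult_distrib[symmetric])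
    finally show ?thesis
      using u by (simp add: bc b card_improper_colorings[OF S True])
  qed
  then show ?thesis
    unfolding list_chromatic_inclusion_exclusion total_dichromatic_def eval_mpoly_sum
      sum_distrib_left
    by (intro sum.cong refl)
      (simp add: eval_mpoly_mult eval_mpoly_power eval_mpoly_prod eval_mpoly_indet assms(7,8))
qed

end
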